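(* Let $(A,\cdot,\circ)$ be a non-trivial simple transposed Novikov-Poisson algebra over $\mathbf{k}$. Then the Novikov algebra $(A,\circ)$ is simple.
   Context: $\mathbf{k}$ is a field of characteristic not equal to $2$; all binary operations are $\mathbf{k}$-bilinear and algebras need not be unital. A (left) Novikov algebra $(A,\circ)$ is a vector space with a binary operation satisfying $(x\circ y)\circ z=(x\circ z)\circ y$ and $(x\circ y)\circ z-x\circ(y\circ z)=(y\circ x)\circ z-y\circ(x\circ z)$ for all $x,y,z$. A transposed Novikov-Poisson algebra is a triple $(A,\cdot,\circ)$ where $(A,\cdot)$ is a commutative associative algebra, $(A,\circ)$ is a Novikov algebra, and for all $x,y,z\in A$: $(x\cdot y)\circ z=(x\cdot z)\circ y$ and $2z\cdot(x\circ y)=(z\cdot x)\circ y+x\circ(z\cdot y)$. It is trivial if $\cdot$ is zero or $\circ$ is zero. An ideal of $(A,\cdot,\circ)$ is a subspace that is a (two-sided) ideal of both $(A,\cdot)$ and $(A,\circ)$; the ideals $0$ and $A$ are called trivial. A non-trivial transposed Novikov-Poisson algebra is simple if it has no non-trivial ideals. A Novikov algebra $(A,\circ)$ is simple if $A\circ A\neq\{0\}$ and its only (two-sided) ideals are $\{0\}$ and $A$. *)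

theory Defs
  imports Complex_Main
begin

text \<open>
  The underlying vector space is given by the library locale \<open>vector_space\<close>: the type \<open>'a\<close> with a scalar
  multiplication by a field \<open>'k\<close>. No dimension restriction is made. The infix \<open>\<odot>\<close> stands for the
  Novikov product usually written as a small circle, which denotes function composition in HOL.
\<close>

locale bilinear_algebra = vector_space scale
  for scale :: "'k::field \<Rightarrow> 'a::ab_group_add \<Rightarrow> 'a" (infixr \<open>*s\<close> 75) +
  fixes mult :: "'a \<Rightarrow> 'a \<Rightarrow> 'a"
  assumes linear_left: "Vector_Spaces.linear scale scale (\<lambda>x. mult x y)"
    and linear_right: "Vector_Spaces.linear scale scale (\<lambda>y. mult x y)"
begin

definition two_sided_ideal :: "'a set \<Rightarrow> bool" where
  "two_sided_ideal I \<longleftrightarrow> subspace I \<and> (\<forall>a. \<forall>x\<in>I. mult a x \<in> I \<and> mult x a \<in> I)"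

end

locale comm_assoc_algebra = bilinear_algebra scale mult
  for scale :: "'k::field \<Rightarrow> 'a::ab_group_add \<Rightarrow> 'a" (infixr \<open>*s\<close> 75)
    and mult :: "'a \<Rightarrow> 'a \<Rightarrow> 'a" (infixl \<open>\<cdot>\<close> 70) +
  assumes commute: "x \<cdot> y = y \<cdot> x"
    and assoc: "(x \<cdot> y) \<cdot> z = x \<cdot> (y \<cdot> z)"

locale novikov_algebra = bilinear_algebra scale nov
  for scale :: "'k::field \<Rightarrow> 'a::ab_group_add \<Rightarrow> 'a" (infixr \<open>*s\<close> 75)
    and nov :: "'a \<Rightarrow> 'a \<Rightarrow> 'a" (infixl \<open>\<odot>\<close> 70) +
  assumes right_commutative: "(x \<odot> y) \<odot> z = (x \<odot> z) \<odot> y"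
    and left_symmetric: "(x \<odot> y) \<odot> z - x \<odot> (y \<odot> z) = (y \<odot> x) \<odot> z - y \<odot> (x \<odot> z)"

text \<open>The subspace \<open>A \<odot> A\<close> is, as usual, the linear span of all products.\<close>

locale simple_novikov_algebra = novikov_algebra scale nov
  for scale :: "'k::field \<Rightarrow> 'a::ab_group_add \<Rightarrow> 'a" (infixr \<open>*s\<close> 75)
    and nov :: "'a \<Rightarrow> 'a \<Rightarrow> 'a" (infixl \<open>\<odot>\<close> 70) +
  assumes square_nonzero: "span {x \<odot> y | x y. True} \<noteq> {0}"
    and ideals_trivial: "two_sided_ideal I \<Longrightarrow> I = {0} \<or> I = UNIV"

locale transposed_novikov_poisson =
  dot: comm_assoc_algebra scale mult + nov: novikov_algebra scale nov
  for scale :: "'k::field \<Rightarrow> 'a::ab_group_add \<Rightarrow> 'a" (infixr \<open>*s\<close> 75)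
    and mult :: "'a \<Rightarrow> 'a \<Rightarrow> 'a" (infixl \<open>\<cdot>\<close> 70)
    and nov :: "'a \<Rightarrow> 'a \<Rightarrow> 'a" (infixl \<open>\<odot>\<close> 70) +
  assumes exchange: "(x \<cdot> y) \<odot> z = (x \<cdot> z) \<odot> y"
    and transposed_leibniz: "2 *s (z \<cdot> (x \<odot> y)) = (z \<cdot> x) \<odot> y + x \<odot> (z \<cdot> y)"
begin

definition trivial :: bool where
  "trivial \<longleftrightarrow> (\<forall>x y. x \<cdot> y = 0) \<or> (\<forall>x y. x \<odot> y = 0)"

definition poisson_ideal :: "'a set \<Rightarrow> bool" where
  "poisson_ideal I \<longleftrightarrow> dot.two_sided_ideal I \<and> nov.two_sided_ideal I"

end

locale simple_transposed_novikov_poisson = transposed_novikov_poisson scale mult nov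
  for scale :: "'k::field \<Rightarrow> 'a::ab_group_add \<Rightarrow> 'a" (infixr \<open>*s\<close> 75)
    and mult :: "'a \<Rightarrow> 'a \<Rightarrow> 'a" (infixl \<open>\<cdot>\<close> 70)
    and nov :: "'a \<Rightarrow> 'a \<Rightarrow> 'a" (infixl \<open>\<odot>\<close> 70) +
  assumes nontrivial: "\<not> trivial"
    and ideals_trivial: "poisson_ideal I \<Longrightarrow> I = {0} \<or> I = UNIV"

end

theory Submission
  imports Defs
begin

text \<open>
  Write \<open>A\<close> for the whole algebra. Two ideals of \<open>(A, \<cdot>, \<odot>)\<close> carry the argument; both are closed under
  \<open>\<cdot>\<close> because the compatibility condition, after division by \<open>2\<close>, rewrites \<open>z \<cdot> (x \<odot> y)\<close> as
  a combination of \<open>\<odot>\<close>-products in which \<open>z\<close> has been moved inside.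

  The first is the square \<open>A \<odot> A\<close>. It is nonzero, so simplicity gives \<open>A \<odot> A = A\<close>.

  The second is attached to an ideal \<open>I\<close> of \<open>(A, \<odot>)\<close>: the elements \<open>x\<close> that send \<open>A\<close> into \<open>I\<close> by left
  multiplication, and all of whose multiples \<open>x \<cdot> b\<close> do so as well. It contains \<open>I\<close>: for \<open>x\<close> in \<open>I\<close>,
  the exchange law gives \<open>(x \<cdot> b) \<odot> a = (b \<cdot> a) \<odot> x\<close>, which lies in \<open>I\<close>. Thus if \<open>I\<close> is nonzero,
  simplicity makes the second ideal all of \<open>A\<close>, which says that \<open>A \<odot> A\<close> is contained in \<open>I\<close>. Together
  with the first step, \<open>I = A\<close>.
\<close>

context bilinear_algebra
begin

lemma mult_add_left: "mult (x + y) z = mult x z + mult y z"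
  and mult_scale_left: "mult (c *s x) z = c *s mult x z"
  and mult_add_right: "mult z (x + y) = mult z x + mult z y"
  and mult_scale_right: "mult z (c *s x) = c *s mult z x"
  using linear_left linear_right unfolding Vector_Spaces.linear_iff by blast+

lemma mult_zero_left: "mult 0 z = 0"
  and mult_zero_right: "mult z 0 = 0"
  using mult_scale_left[of 0 0 z] mult_scale_right[of z 0 0] by simp_all

lemma two_sided_ideal_span:
  assumes left: "\<And>a s. s \<in> S \<Longrightarrow> mult a s \<in> span S"
    and right: "\<And>a s. s \<in> S \<Longrightarrow> mult s a \<in> span S"
  shows "two_sided_ideal (span S)"
proof -
  have "mult a x \<in> span S \<and> mult x a \<in> span S" if "x \<in> span S" for a x
    using that
    by (induction rule: span_induct_alt)
      (auto simp: left right mult_zero_left mult_zero_right mult_add_left mult_add_right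
        mult_scale_left mult_scale_right span_zero intro!: span_add span_scale)
  then show ?thesis
    by (simp add: two_sided_ideal_def)
qed

end

context transposed_novikov_poisson
begin

text \<open>
  This is the compatibility condition divided by \<open>2\<close>, used for two linear maps \<open>f\<close>: the identity, for
  the square of the algebra, and right multiplication by an element, for the ideal of elements that
  act into a given ideal.
\<close>

lemma linear_image_mult_nov_mem:
  assumes two: "(2 :: 'k) \<noteq> 0" and S: "dot.subspace S"
    and mem: "f ((z \<cdot> x) \<odot> y) \<in> S" "f (x \<odot> (z \<cdot> y)) \<in> S"
    and f_add: "\<And>u v. f (u + v) = f u + f v" and f_scale: "\<And>c u. f (c *s u) = c *s f u"
  shows "f (z \<cdot> (x \<odot> y)) \<in> S"
proof -
  have "2 *s f (z \<cdot> (x \<odot> y)) = f ((z \<cdot> x) \<odot> y) + f (x \<odot> (z \<cdot> y))"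
    by (metis f_add f_scale transposed_leibniz)
  then have "2 *s f (z \<cdot> (x \<odot> y)) \<in> S"
    using S mem by (simp add: dot.subspace_add)
  then have "inverse 2 *s (2 *s f (z \<cdot> (x \<odot> y))) \<in> S"
    using S by (blast intro: dot.subspace_scale)
  then show ?thesis
    using two by simp
qed

lemma poisson_ideal_nov_square:
  assumes two: "(2 :: 'k) \<noteq> 0"
  shows "poisson_ideal (dot.span {x \<odot> y | x y. True})"
proof -
  let ?S = "dot.span {x \<odot> y | x y. True}"
  have gen: "x \<odot> y \<in> ?S" for x y
    by (auto intro: dot.span_base)
  have left: "z \<cdot> (x \<odot> y) \<in> ?S" for x y z
    using linear_image_mult_nov_mem[of ?S "\<lambda>u. u"] two gen by simp
  then have right: "(x \<odot> y) \<cdot> z \<in> ?S" for x y z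
    by (metis dot.commute)
  show ?thesis
    unfolding poisson_ideal_def
    using left right gen
    by (auto intro!: dot.two_sided_ideal_span nov.two_sided_ideal_span)
qed

text \<open>
  If \<open>x\<close> acts into \<open>I\<close> from the left, then so does \<open>x \<odot> c\<close> because \<open>I\<close> absorbs \<open>\<odot>\<close>, and so does
  \<open>c \<odot> x\<close> by left symmetry, which trades \<open>(c \<odot> x) \<odot> a\<close> for products containing a factor \<open>x \<odot> u\<close>.
  Requiring the condition of all \<open>x \<cdot> b\<close> as well makes the set absorb \<open>\<cdot>\<close>; this second condition is
  inherited by \<open>x \<odot> c\<close> and \<open>c \<odot> x\<close> by moving \<open>b\<close> inside the product.
\<close>

lemma poisson_ideal_left_transporter:
  assumes two: "(2 :: 'k) \<noteq> 0" and I: "nov.two_sided_ideal I"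
  shows "poisson_ideal {x. (\<forall>a. x \<odot> a \<in> I) \<and> (\<forall>a b. (x \<cdot> b) \<odot> a \<in> I)}"
    (is "poisson_ideal ?N")
proof -
  have sub: "dot.subspace I"
    and Il: "\<And>a x. x \<in> I \<Longrightarrow> a \<odot> x \<in> I" and Ir: "\<And>a x. x \<in> I \<Longrightarrow> x \<odot> a \<in> I"
    using I by (auto simp: nov.two_sided_ideal_def)
  have N_nov: "x \<odot> a \<in> I" and N_dot_nov: "(x \<cdot> b) \<odot> a \<in> I" if "x \<in> ?N" for x a b
    using that by auto
  have subN: "dot.subspace ?N"
    by (rule dot.subspaceI)
      (auto simp: nov.mult_zero_left dot.mult_zero_left nov.mult_add_left dot.mult_add_left
        nov.mult_scale_left dot.mult_scale_left
        intro: dot.subspace_0[OF sub] dot.subspace_add[OF sub] dot.subspace_scale[OF sub])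
  have dot_right: "x \<cdot> c \<in> ?N" if "x \<in> ?N" for x c
    using N_dot_nov[OF that] by (auto simp: dot.assoc)
  then have dot_left: "c \<cdot> x \<in> ?N" if "x \<in> ?N" for x c
    using that by (subst dot.commute)
  have right_act: "(x \<odot> c) \<odot> a \<in> I" if "x \<in> ?N" for x c a
    using N_nov[OF that] by (rule Ir)
  have left_act: "(c \<odot> x) \<odot> a \<in> I" if x: "x \<in> ?N" for x c a
  proof -
    have "(c \<odot> x) \<odot> a = c \<odot> (x \<odot> a) + ((x \<odot> c) \<odot> a - x \<odot> (c \<odot> a))"
      using nov.left_symmetric[of c x a] by (simp add: algebra_simps)
    then show ?thesis
      using N_nov[OF x] Il Ir by (auto intro!: dot.subspace_add[OF sub] dot.subspace_diff[OF sub])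
  qed
  have nov_right: "x \<odot> c \<in> ?N" if x: "x \<in> ?N" for x c
  proof -
    have "(b \<cdot> (x \<odot> c)) \<odot> a \<in> I" for a b
      using linear_image_mult_nov_mem[OF two sub, of "\<lambda>u. u \<odot> a"]
        right_act[OF dot_left[OF x]] right_act[OF x] nov.mult_add_left nov.mult_scale_left
      by blast
    then show ?thesis
      using right_act[OF x] dot.commute by auto
  qed
  have nov_left: "c \<odot> x \<in> ?N" if x: "x \<in> ?N" for x c
  proof -
    have "(b \<cdot> (c \<odot> x)) \<odot> a \<in> I" for a b
      using linear_image_mult_nov_mem[OF two sub, of "\<lambda>u. u \<odot> a"]
        left_act[OF dot_left[OF x]] left_act[OF x] nov.mult_add_left nov.mult_scale_left
      by blast
    then show ?thesis
      using left_act[OF x] dot.commute by auto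
  qed
  show ?thesis
    unfolding poisson_ideal_def dot.two_sided_ideal_def nov.two_sided_ideal_def
    using subN dot_left dot_right nov_left nov_right by blast
qed

lemma ideal_subset_left_transporter:
  assumes "nov.two_sided_ideal I"
  shows "I \<subseteq> {x. (\<forall>a. x \<odot> a \<in> I) \<and> (\<forall>a b. (x \<cdot> b) \<odot> a \<in> I)}"
proof
  fix x assume "x \<in> I"
  moreover have "(x \<cdot> b) \<odot> a = (b \<cdot> a) \<odot> x" for a b
    by (metis dot.commute exchange)
  ultimately show "x \<in> {x. (\<forall>a. x \<odot> a \<in> I) \<and> (\<forall>a b. (x \<cdot> b) \<odot> a \<in> I)}"
    using assms by (auto simp: nov.two_sided_ideal_def)
qed

end

theorem theorem4p8:
  fixes scale :: "'k::field \<Rightarrow> 'a::ab_group_add \<Rightarrow> 'a"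
    and mult nov :: "'a \<Rightarrow> 'a \<Rightarrow> 'a"
  assumes "CHAR('k) \<noteq> 2"
    and "simple_transposed_novikov_poisson scale mult nov"
  shows "simple_novikov_algebra scale nov"
proof -
  interpret simple_transposed_novikov_poisson scale mult nov
    by (fact assms(2))
  have two: "(2 :: 'k) \<noteq> 0"
  proof
    assume "(2 :: 'k) = 0"
    then have "CHAR('k) dvd 2"
      using of_nat_eq_0_iff_char_dvd[where 'a = 'k, of 2] by simp
    then have "CHAR('k) \<le> 2" "CHAR('k) \<noteq> 0"
      by (auto dest: dvd_imp_le intro!: Nat.gr0I)
    moreover have "CHAR('k) \<noteq> 1"
      using of_nat_CHAR[where 'a = 'k] by force
    ultimately show False
      using assms(1) by linarith
  qed
  let ?S = "dot.span {nov x y | x y. True}"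
  have square_nonzero: "?S \<noteq> {0}"
    using nontrivial dot.span_base[of _ "{nov x y | x y. True}"] by (fastforce simp: trivial_def)
  then have square_UNIV: "?S = UNIV"
    using ideals_trivial[OF poisson_ideal_nov_square[OF two]] by blast
  have "I = {0} \<or> I = UNIV" if I: "nov.two_sided_ideal I" for I
  proof (rule disjCI)
    assume "I \<noteq> UNIV"
    have sub: "dot.subspace I"
      using I by (simp add: nov.two_sided_ideal_def)
    let ?N = "{x. (\<forall>a. nov x a \<in> I) \<and> (\<forall>a b. nov (mult x b) a \<in> I)}"
    have "?N \<noteq> UNIV"
    proof
      assume "?N = UNIV"
      then have "{nov x y | x y. True} \<subseteq> I"
        by blast
      then have "?S \<subseteq> I"
        using sub by (rule dot.span_minimal)
      with square_UNIV \<open>I \<noteq> UNIV\<close> show False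
        by blast
    qed
    then have "?N = {0}"
      using ideals_trivial[OF poisson_ideal_left_transporter[OF two I]] by blast
    then show "I = {0}"
      using ideal_subset_left_transporter[OF I] dot.subspace_0[OF sub] by blast
  qed
  with square_nonzero show ?thesis
    by unfold_locales auto
qed

end
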